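(* Let $\psi(a,c,x)$ denote the Tricomi confluent hypergeometric function of the second kind. (i) If $a>0$, $c<1$ and $x>0$, then $$\frac{c-a-1}{x^2}\psi^2(a,c,x)<\psi^2(a,c,x)-\psi(a-1,c-1,x)\psi(a+1,c+1,x).$$ (ii) If $a>1$, $c<-1$ and $x>0$, then $$\psi^2(a,c,x)-\psi(a-1,c-1,x)\psi(a+1,c+1,x)<\left(\frac{1}{c}+2x\left(\frac{c-a}{c^2(c+1)}\right)\right)\psi^2(a,c,x).$$ (iii) If $a>0$, $c<1$ and $x>0$, then $$-\frac{1}{2x}\psi^2(a,c,x)<\psi^2(a,c,x)-\psi(a-1,c-1,x)\psi(a+1,c+1,x).$$ Moreover, the inequalities in (i) and (iii) are sharp as $x\to\infty$, and the inequality in (ii) is sharp as $x\to 0$ (from the right), where "sharp" means that, after dividing by $\psi^2(a,c,x)$, the two sides of the inequality have the same finite limit as $x$ tends to the indicated endpoint.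
   Context: For real $a,c$ and $x>0$, $\psi(a,c,x)$ is the Tricomi confluent hypergeometric function of the second kind (often written $U(a,c,x)$): the particular solution on $(0,\infty)$ of Kummer's differential equation $xy''(x)+(c-x)y'(x)-ay(x)=0$ characterized by $x^{a}\psi(a,c,x)\to 1$ as $x\to\infty$. For $a>0$, $c\in\mathbb{R}$, $x>0$ it has the integral representation $$\psi(a,c,x)=\frac{1}{\Gamma(a)}\int_{0}^{\infty}e^{-xt}t^{a-1}(1+t)^{c-a-1}\,dt.$$ Notation: $\psi^2(a,c,x)=(\psi(a,c,x))^2$. *)

theory Defs
  imports "HOL-Analysis.Analysis"
begin

definition kummer_solution :: "real \<Rightarrow> real \<Rightarrow> (real \<Rightarrow> real) \<Rightarrow> bool" where
  "kummer_solution a c y \<longleftrightarrow>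
     (\<exists>y' y''. \<forall>x>0.
        (y has_real_derivative y' x) (at x) \<and>
        (y' has_real_derivative y'' x) (at x) \<and>
        x * y'' x + (c - x) * y' x - a * y x = 0)"

(* For all real a and c exactly one Kummer solution on the positive half-line has the
   prescribed behaviour at infinity: any solution that is linearly independent of it grows
   like a multiple of exp x * x powr (a - c). The description is applied to the value at x
   rather than to the function, because the conditions on y say nothing about y x for
   x \<le> 0. The value at x \<le> 0 is therefore unspecified. *)
definition tricomi :: "real \<Rightarrow> real \<Rightarrow> real \<Rightarrow> real" where
  "tricomi a c x =
     (THE v. \<exists>y. kummer_solution a c y \<and>
        ((\<lambda>t. t powr a * y t) \<longlongrightarrow> 1) at_top \<and> v = y x)"

(* The two sides l and r of an inequality have, after division by d, the same finite limit
   along F. *)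
definition sharp_rel :: "(real \<Rightarrow> real) \<Rightarrow> (real \<Rightarrow> real) \<Rightarrow> (real \<Rightarrow> real) \<Rightarrow> real filter \<Rightarrow> bool" where
  "sharp_rel d l r F \<longleftrightarrow>
     (\<exists>L. ((\<lambda>x. l x / d x) \<longlongrightarrow> L) F \<and> ((\<lambda>x. r x / d x) \<longlongrightarrow> L) F)"

end

(* For a > 0 and c < 1 the function y = tricomi a c is a Laplace integral; an integration by
   parts yields Kummer's equation, and the Wronskian singles y out by its behaviour at infinity.
   Moreover tricomi (a + 1) (c + 1) = - y' / a and tricomi (a - 1) (c - 1) = (x + 1 - c) y - x y'.
   Put b = 1 - c and h = - x y' / y. Then 0 < h < a,
     x h' = h^2 + (x + b) h - a x,
   and the Turan determinant of y equals - (h' / a) y^2, so all the claims are bounds for h'.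
   Each of them is proved in the same way: if the bound failed at one point, the differential
   equation of h' (or h'') would make it fail from there on, and h would be unbounded or h'
   would become negative. *)
theory Submission
  imports Defs "HOL-Real_Asymp.Real_Asymp"
begin

section \<open>The Laplace integral\<close>

text \<open>On the side of the special function the obstacle is
  \<open>tricomi (a - 1) (c - 1)\<close>: for \<open>a \<le> 1\<close> its Laplace integral diverges
  at 0, so it has to be recognised by its differential equation and its behaviour at infinity. The
  estimates use no asymptotic expansion at infinity: once \<open>h'\<close> stays above a positive
  multiple of 1/x, or below a negative one, \<open>h\<close> leaves the interval from 0 to
  \<open>a\<close>. The thresholds come from the equations themselves. With
  \<open>g = x * h'\<close> one has x g' = (2h + x + b + 1) g - h (h + b), with a single negative
  term. Absorbing it into x g gives the threshold a (a + b) / x of (i); absorbing it into the whole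
  first term gives the threshold a / 2 of (iii). The bound in (ii) is affine in x. Its value and
  slope at 0 are those which the equations of \<open>h'\<close> and \<open>h''\<close> force there,
  hence the further differentiation and the limit at 0. The condition c < -1, that is b > 2, is what
  makes the coefficient b - 2 in the equation of \<open>h''\<close> positive.\<close>

lemma has_bochner_integral_Gamma_scaled:
  fixes s x :: real
  assumes "s > 0" "x > 0"
  shows "has_bochner_integral lborel
           (\<lambda>t. indicator {0<..} t *\<^sub>R (exp (- (x * t)) * t powr (s - 1))) (Gamma s / x powr s)"
proof -
  define f where "f t = indicator {0..} t * t powr (s - 1) / exp t" for t :: real
  have "has_bochner_integral lborel f (Gamma s)"
  proof (rule has_bochner_integral_nn_integral)
    show "f \<in> borel_measurable lborel" unfolding f_def by measurable
    show "AE t in lborel. 0 \<le> f t" by (simp add: f_def)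
    show "0 \<le> Gamma s" using assms by (simp add: Gamma_real_nonneg)
    show "(\<integral>\<^sup>+ t. ennreal (f t) \<partial>lborel) = ennreal (Gamma s)"
      unfolding f_def using Gamma_conv_nn_integral_real[OF assms(1)] by simp
  qed
  then have "has_bochner_integral lborel (\<lambda>t. f (0 + x * t)) (Gamma s /\<^sub>R \<bar>x\<bar>)"
    using lborel_has_bochner_integral_real_affine_iff[of x f "Gamma s" 0] assms by simp
  then have "has_bochner_integral lborel (\<lambda>t. f (0 + x * t) * (1 / x powr (s - 1)))
      ((Gamma s /\<^sub>R \<bar>x\<bar>) * (1 / x powr (s - 1)))"
    by (rule has_bochner_integral_mult_left)
  also have "(\<lambda>t. f (0 + x * t) * (1 / x powr (s - 1)))
      = (\<lambda>t. indicator {0<..} t *\<^sub>R (exp (- (x * t)) * t powr (s - 1)))"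
    using assms
    by (auto simp: f_def fun_eq_iff indicator_def powr_mult exp_minus field_simps
        zero_le_mult_iff mult_less_0_iff)
  also have "(Gamma s /\<^sub>R \<bar>x\<bar>) * (1 / x powr (s - 1)) = Gamma s / x powr s"
    using assms by (simp add: powr_diff field_simps)
  finally show ?thesis .
qed

text \<open>Up to the factor \<open>Gamma a\<close>, \<open>tricomi a c\<close> is the case
  \<open>s = a\<close>, \<open>e = c - a - 1\<close>. In these parameters differentiation in
  \<open>x\<close> raises \<open>s\<close> alone, and raising \<open>a\<close> and \<open>c\<close>
  together keeps \<open>e\<close>. One family thus covers the function, its derivatives and its
  upper neighbour.\<close>

definition tricomi_int :: "real \<Rightarrow> real \<Rightarrow> real \<Rightarrow> real" where
  "tricomi_int s e x =
     (LINT t:{0<..}|lborel. exp (- (x * t)) * t powr (s - 1) * (1 + t) powr e)"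

lemma Gamma_scaled_integral:
  fixes s x :: real
  assumes "s > 0" "x > 0"
  shows "set_integrable lborel {0<..} (\<lambda>t. exp (- (x * t)) * t powr (s - 1))"
    and "(LINT t:{0<..}|lborel. exp (- (x * t)) * t powr (s - 1)) = Gamma s / x powr s"
  using has_bochner_integral_Gamma_scaled[OF assms]
  by (auto simp: set_integrable_def set_lebesgue_integral_def has_bochner_integral_iff)

lemma tricomi_int_integrable:
  fixes s e x :: real
  assumes "s > 0" "e \<le> 0" "x > 0"
  shows "set_integrable lborel {0<..} (\<lambda>t. exp (- (x * t)) * t powr (s - 1) * (1 + t) powr e)"
proof (rule set_integrable_bound[OF Gamma_scaled_integral(1)[OF assms(1,3)]])
  show "set_borel_measurable lborel {0<..} (\<lambda>t. exp (- (x * t)) * t powr (s - 1) * (1 + t) powr e)"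
    unfolding set_borel_measurable_def by measurable
  have "(1 + t) powr e \<le> 1" if "t > 0" for t :: real
    using that assms powr_mono[of e 0 "1 + t"] by simp
  then show "AE t in lborel. t \<in> {0<..} \<longrightarrow> norm (exp (- (x * t)) * t powr (s - 1) * (1 + t) powr e)
        \<le> norm (exp (- (x * t)) * t powr (s - 1))"
    by (auto intro!: AE_I2 mult_right_le_one_le simp: abs_mult)
qed

lemma tricomi_int_le:
  assumes "s > 0" "e \<le> 0" "x > 0"
  shows "tricomi_int s e x \<le> Gamma s / x powr s"
proof -
  have "(1 + t) powr e \<le> 1" if "t > 0" for t :: real
    using that assms powr_mono[of e 0 "1 + t"] by simp
  then show ?thesis
  unfolding tricomi_int_def Gamma_scaled_integral(2)[OF assms(1,3), symmetric]
  using assms by (intro set_integral_mono tricomi_int_integrable Gamma_scaled_integral)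
    (auto intro!: mult_right_le_one_le)
qed

text \<open>Since \<open>ln (1 + t) \<le> t\<close> and \<open>e \<le> 0\<close>, the factor
  \<open>(1 + t) powr e\<close> is at least \<open>exp (e * t)\<close>, which merely moves
  \<open>x\<close> to \<open>x - e\<close> in the Gamma integral. The ratio of this bound to the
  upper bound \<open>Gamma s / x powr s\<close> tends to 1, and this settles the
  asymptotics.\<close>

lemma tricomi_int_ge:
  assumes "s > 0" "e \<le> 0" "x > 0"
  shows "Gamma s / (x - e) powr s \<le> tricomi_int s e x"
proof -
  have xe: "x - e > 0" using assms by simp
  have "exp (- ((x - e) * t)) * t powr (s - 1) \<le> exp (- (x * t)) * t powr (s - 1) * (1 + t) powr e"
    if "t > 0" for t
  proof -
    have "exp (e * t) \<le> exp (e * ln (1 + t))"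
      using that assms ln_add_one_self_le_self2[of t] by (simp add: mult_left_mono_neg)
    then have "exp (e * t) \<le> (1 + t) powr e"
      using that by (simp add: powr_def)
    moreover have "exp (- ((x - e) * t)) = exp (- (x * t)) * exp (e * t)"
      by (simp add: exp_add[symmetric] algebra_simps)
    ultimately show ?thesis
      using mult_left_mono[of "exp (e * t)" "(1 + t) powr e" "exp (- (x * t)) * t powr (s - 1)"]
      by (simp add: mult_ac)
  qed
  then show ?thesis
    unfolding tricomi_int_def Gamma_scaled_integral(2)[OF assms(1) xe, symmetric]
    using assms xe by (intro set_integral_mono tricomi_int_integrable Gamma_scaled_integral) auto
qed

lemma tricomi_int_pos:
  assumes "s > 0" "e \<le> 0" "x > 0"
  shows "tricomi_int s e x > 0"
  using tricomi_int_ge[OF assms] assms Gamma_real_pos[of s]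
  by (smt (verit) divide_pos_pos powr_gt_zero)

lemma tricomi_int_asymp:
  assumes "s > 0" "e \<le> 0"
  shows "((\<lambda>x. x powr s * tricomi_int s e x) \<longlongrightarrow> Gamma s) at_top"
proof (rule tendsto_sandwich)
  show "\<forall>\<^sub>F x in at_top. x powr s * (Gamma s / (x - e) powr s) \<le> x powr s * tricomi_int s e x"
    using eventually_gt_at_top[of 0] by eventually_elim (intro mult_left_mono tricomi_int_ge assms; simp)
  show "\<forall>\<^sub>F x in at_top. x powr s * tricomi_int s e x \<le> Gamma s"
    using eventually_gt_at_top[of 0]
  proof eventually_elim
    case (elim x)
    show ?case using tricomi_int_le[OF assms elim] elim by (simp add: field_simps)
  qed
  have "((\<lambda>x. (x / (x - e)) powr s * Gamma s) \<longlongrightarrow> 1 powr s * Gamma s) at_top"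
    by (intro tendsto_intros) (real_asymp | simp)+
  moreover have "\<forall>\<^sub>F x in at_top. (x / (x - e)) powr s * Gamma s = x powr s * (Gamma s / (x - e) powr s)"
    using eventually_gt_at_top[of 0]
    by eventually_elim (use assms in \<open>simp add: powr_divide\<close>)
  ultimately show "((\<lambda>x. x powr s * (Gamma s / (x - e) powr s)) \<longlongrightarrow> Gamma s) at_top"
    by (simp cong: filterlim_cong add: Lim_transform_eventually)
qed simp

section \<open>Recurrences, Kummer's equation and differentiation under the integral\<close>

lemma tricomi_int_contiguous:
  assumes "s > 0" "e \<le> 0" "x > 0"
  shows "tricomi_int s (e - 1) x + tricomi_int (s + 1) (e - 1) x = tricomi_int s e x"
proof -
  have "exp (- (x * t)) * t powr (s - 1) * (1 + t) powr (e - 1)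
      + exp (- (x * t)) * t powr (s + 1 - 1) * (1 + t) powr (e - 1)
      = exp (- (x * t)) * t powr (s - 1) * (1 + t) powr e" if "t > 0" for t :: real
  proof -
    have "t powr s = t powr (s - 1) * t" "(1 + t) powr e = (1 + t) powr (e - 1) * (1 + t)"
      using that powr_add[of t "s - 1" 1] powr_add[of "1 + t" "e - 1" 1] by auto
    then show ?thesis by (simp add: algebra_simps)
  qed
  then have "tricomi_int s e x = (LINT t:{0<..}|lborel.
      exp (- (x * t)) * t powr (s - 1) * (1 + t) powr (e - 1)
      + exp (- (x * t)) * t powr (s + 1 - 1) * (1 + t) powr (e - 1))"
    unfolding tricomi_int_def by (intro set_lebesgue_integral_cong) auto
  also have "\<dots> = tricomi_int s (e - 1) x + tricomi_int (s + 1) (e - 1) x"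
    unfolding tricomi_int_def
    by (intro set_integral_add(2) tricomi_int_integrable) (use assms in auto)
  finally show ?thesis by simp
qed

text \<open>The three terms form the integral of the derivative of \<open>F\<close>, which vanishes
  at both ends: at 0 because \<open>s > 0\<close>, at infinity because \<open>x > 0\<close>.\<close>

lemma tricomi_int_by_parts:
  assumes "s > 0" "e \<le> 0" "x > 0"
  shows "s * tricomi_int s e x - x * tricomi_int (s + 1) e x + e * tricomi_int (s + 1) (e - 1) x = 0"
proof -
  define w where "w s e t = exp (- (x * t)) * t powr (s - 1) * (1 + t) powr e" for s e t :: real
  define f where "f t = s * w s e t - x * w (s + 1) e t + e * w (s + 1) (e - 1) t" for t
  define F where "F t = exp (- (x * t)) * t powr s * (1 + t) powr e" for t
  have int: "set_integrable lborel {0<..} (w s e)" "set_integrable lborel {0<..} (w (s + 1) e)"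
    "set_integrable lborel {0<..} (w (s + 1) (e - 1))"
    unfolding w_def using assms by (intro tricomi_int_integrable; simp)+
  have E: "einterval 0 \<infinity> = {0<..}" by (auto simp: einterval_def)
  have "(LBINT t=0..\<infinity>. f t) = 0 - 0"
  proof (rule interval_integral_FTC_integrable[where F = F])
    fix t :: real assume "0 < ereal t" "ereal t < \<infinity>"
    then have t: "t > 0" by simp
    have "(F has_real_derivative
        (exp (- (x * t)) * (- x) * t powr s * (1 + t) powr e
        + exp (- (x * t)) * (s * t powr (s - 1)) * (1 + t) powr e
        + exp (- (x * t)) * t powr s * (e * (1 + t) powr (e - 1)))) (at t)"
      unfolding F_def using t by (auto intro!: derivative_eq_intros simp: algebra_simps)
    moreover have "exp (- (x * t)) * (- x) * t powr s * (1 + t) powr e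
        + exp (- (x * t)) * (s * t powr (s - 1)) * (1 + t) powr e
        + exp (- (x * t)) * t powr s * (e * (1 + t) powr (e - 1)) = f t"
      by (simp add: f_def w_def algebra_simps)
    ultimately show "(F has_vector_derivative f t) (at t)"
      by (simp add: has_real_derivative_iff_has_vector_derivative)
    show "isCont f t" unfolding f_def w_def using t by (auto intro!: continuous_intros)
  next
    show "set_integrable lborel (einterval 0 \<infinity>) f"
      unfolding E f_def using int by auto
    have "(F \<longlongrightarrow> 0) (at_right 0)" unfolding F_def using assms by real_asymp
    then show "((F \<circ> real_of_ereal) \<longlongrightarrow> 0) (at_right 0)"
      by (simp add: ereal_tendsto_simps zero_ereal_def)
    have "(F \<longlongrightarrow> 0) at_top" unfolding F_def using assms by real_asymp
    then show "((F \<circ> real_of_ereal) \<longlongrightarrow> 0) (at_left \<infinity>)"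
      by (simp add: ereal_tendsto_simps)
  qed simp
  then have "(LINT t:{0<..}|lborel. f t) = 0"
    by (simp add: interval_lebesgue_integral_def E)
  moreover have "(LINT t:{0<..}|lborel. f t) = s * (LINT t:{0<..}|lborel. w s e t)
      - x * (LINT t:{0<..}|lborel. w (s + 1) e t) + e * (LINT t:{0<..}|lborel. w (s + 1) (e - 1) t)"
    unfolding f_def using int by (simp add: set_integral_add set_integral_diff)
  ultimately show ?thesis unfolding tricomi_int_def w_def by simp
qed

text \<open>This is Kummer's equation with \<open>c = s + 1 + e\<close>, since
  \<open>tricomi_int (s + 1) e\<close> and \<open>tricomi_int (s + 2) e\<close> are minus the first
  and the second derivative. In the sum of the integrations by parts for \<open>s\<close> and
  \<open>s + 1\<close>, the integrals with exponent \<open>e - 1\<close> occur only in the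
  combination that contiguity evaluates.\<close>

lemma tricomi_int_kummer:
  assumes "s > 0" "e \<le> 0" "x > 0"
  shows "x * tricomi_int (s + 2) e x = s * tricomi_int s e x + (s + 1 + e - x) * tricomi_int (s + 1) e x"
proof -
  have "(s + 1) * tricomi_int (s + 1) e x - x * tricomi_int (s + 2) e x
      + e * tricomi_int (s + 2) (e - 1) x = 0"
    using tricomi_int_by_parts[of "s + 1" e x] assms by (simp add: add.assoc)
  moreover have "tricomi_int (s + 1) (e - 1) x + tricomi_int (s + 2) (e - 1) x = tricomi_int (s + 1) e x"
    using tricomi_int_contiguous[of "s + 1" e x] assms by (simp add: add.assoc)
  ultimately show ?thesis
    using tricomi_int_by_parts[OF assms] by algebra
qed

lemma exp_minus_taylor2_le:
  fixes u :: real
  shows "\<bar>exp (- u) - 1 + u\<bar> \<le> u\<^sup>2 * exp \<bar>u\<bar>"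
  using Taylor_exp_field[of "- u" 1]
  by (simp add: power2_eq_square abs_minus_commute mult_ac algebra_simps)

text \<open>Expanding \<open>exp (- (d * t))\<close> under the integral costs a factor
  \<open>exp \<bar>d * t\<bar>\<close>. For \<open>\<bar>d\<bar> \<le> x / 2\<close> half of the
  decay of \<open>exp (- (x * t))\<close> pays for it, so the integral in the bound does not depend
  on \<open>d\<close>.\<close>

lemma tricomi_int_derivative_remainder:
  assumes "s > 0" "e \<le> 0" "x > 0" "\<bar>d\<bar> \<le> x / 2"
  shows "\<bar>tricomi_int s e (x + d) - tricomi_int s e x + d * tricomi_int (s + 1) e x\<bar>
       \<le> d\<^sup>2 * tricomi_int (s + 2) e (x / 2)"
proof -
  define w where "w s x t = exp (- (x * t)) * t powr (s - 1) * (1 + t) powr e" for s x t :: real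
  have I: "tricomi_int s e x = (LINT t:{0<..}|lborel. w s x t)" for s x
    by (simp add: tricomi_int_def w_def)
  have xd: "x + d > 0" using assms by linarith
  have int: "set_integrable lborel {0<..} (w s (x + d))" "set_integrable lborel {0<..} (w s x)"
     "set_integrable lborel {0<..} (w (s + 1) x)" "set_integrable lborel {0<..} (w (s + 2) (x / 2))"
    unfolding w_def using assms xd by (intro tricomi_int_integrable; simp)+
  have *: "\<bar>w s (x + d) t - w s x t + d * w (s + 1) x t\<bar> \<le> d\<^sup>2 * w (s + 2) (x / 2) t" if "t > 0" for t
  proof -
    have p: "t powr s = t powr (s - 1) * t" "t powr (s + 1) = t powr (s - 1) * t\<^sup>2"
      using that powr_add[of t "s - 1" 1] powr_add[of t "s - 1" 2]
      by (auto simp: powr_numeral add.commute)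
    have "w s (x + d) t - w s x t + d * w (s + 1) x t = w s x t * (exp (- (d * t)) - 1 + d * t)"
      by (simp add: w_def p algebra_simps exp_add[symmetric] exp_diff exp_minus divide_inverse)
    then have "\<bar>w s (x + d) t - w s x t + d * w (s + 1) x t\<bar> \<le> w s x t * ((d * t)\<^sup>2 * exp \<bar>d * t\<bar>)"
      using exp_minus_taylor2_le[of "d * t"] by (simp add: abs_mult w_def mult_left_mono)
    also have "\<dots> = d\<^sup>2 * (exp (- (x * t) + \<bar>d * t\<bar>) * t powr (s + 1) * (1 + t) powr e)"
      unfolding exp_add by (simp add: w_def p power_mult_distrib mult_ac)
    also have "\<dots> \<le> d\<^sup>2 * (exp (- (x / 2 * t)) * t powr (s + 1) * (1 + t) powr e)"
    proof -
      have "\<bar>d * t\<bar> \<le> x / 2 * t" using assms that by (simp add: abs_mult)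
      then show ?thesis by (intro mult_left_mono mult_right_mono) auto
    qed
    also have "\<dots> = d\<^sup>2 * w (s + 2) (x / 2) t" by (simp add: w_def add.commute)
    finally show ?thesis .
  qed
  let ?g = "\<lambda>t. w s (x + d) t - w s x t + d * w (s + 1) x t"
  have g: "set_integrable lborel {0<..} ?g" using int by auto
  have "\<bar>LINT t:{0<..}|lborel. ?g t\<bar> \<le> (LINT t:{0<..}|lborel. \<bar>?g t\<bar>)"
    using set_integral_norm_bound[OF g] by simp
  also have "\<dots> \<le> (LINT t:{0<..}|lborel. d\<^sup>2 * w (s + 2) (x / 2) t)"
    by (intro set_integral_mono set_integrable_abs g) (use int * in auto)
  finally show ?thesis
    using int by (simp add: I set_integral_add set_integral_diff)
qed

lemma tricomi_int_has_derivative: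
  assumes "s > 0" "e \<le> 0" "x > 0"
  shows "(tricomi_int s e has_real_derivative - tricomi_int (s + 1) e x) (at x)"
proof -
  define K where "K = tricomi_int (s + 2) e (x / 2)"
  have "((\<lambda>d. (tricomi_int s e (x + d) - tricomi_int s e x) / d - (- tricomi_int (s + 1) e x)) \<longlongrightarrow> 0) (at 0)"
  proof (rule Lim_null_comparison)
    have "\<forall>\<^sub>F d in at (0::real). \<bar>d\<bar> < x / 2"
      by (rule order_tendstoD(2)[of _ 0]) (use assms in \<open>auto intro!: tendsto_eq_intros\<close>)
    moreover have "\<forall>\<^sub>F d in at (0::real). d \<noteq> 0" by (simp add: eventually_at_filter)
    ultimately show "\<forall>\<^sub>F d in at 0. norm ((tricomi_int s e (x + d) - tricomi_int s e x) / d
        - (- tricomi_int (s + 1) e x)) \<le> \<bar>d\<bar> * K"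
    proof eventually_elim
      case (elim d)
      then have "\<bar>(tricomi_int s e (x + d) - tricomi_int s e x + d * tricomi_int (s + 1) e x) / d\<bar>
          \<le> d\<^sup>2 * K / \<bar>d\<bar>"
        using tricomi_int_derivative_remainder[OF assms, of d]
        by (simp add: K_def abs_divide divide_right_mono)
      moreover have "d\<^sup>2 * K / \<bar>d\<bar> = \<bar>d\<bar> * K"
        using elim by (simp add: power2_eq_square abs_if)
      ultimately show ?case using elim by (simp add: add_divide_distrib diff_divide_distrib)
    qed
    show "((\<lambda>d. \<bar>d\<bar> * K) \<longlongrightarrow> 0) (at 0)" by (auto intro!: tendsto_eq_intros)
  qed
  then show ?thesis unfolding DERIV_def by (rule LIM_zero_cancel)
qed

section \<open>Uniqueness of the Tricomi function\<close>

text \<open>Here \<open>v\<close> is an arbitrary competitor, as the definite description in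
  \<open>tricomi\<close> demands, and positivity of \<open>u\<close> makes the quotient
  \<open>v / u\<close> available. Its derivative is a constant multiple of a function that tends to
  infinity, whereas the quotient tends to 1; hence the constant is 0.\<close>

lemma kummer_solution_unique:
  fixes u v :: "real \<Rightarrow> real"
  assumes u: "kummer_solution a c u" and v: "kummer_solution a c v"
    and pos: "\<And>t. t > 0 \<Longrightarrow> u t > 0"
    and lim_u: "((\<lambda>t. t powr a * u t) \<longlongrightarrow> 1) at_top"
    and lim_v: "((\<lambda>t. t powr a * v t) \<longlongrightarrow> 1) at_top"
    and x: "x > 0"
  shows "v x = u x"
proof -
  obtain u' u'' where u: "(u has_real_derivative u' t) (at t)" "(u' has_real_derivative u'' t) (at t)"
      "t * u'' t + (c - t) * u' t - a * u t = 0" if "t > 0" for t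
    using u unfolding kummer_solution_def by blast
  obtain v' v'' where v: "(v has_real_derivative v' t) (at t)" "(v' has_real_derivative v'' t) (at t)"
      "t * v'' t + (c - t) * v' t - a * v t = 0" if "t > 0" for t
    using v unfolding kummer_solution_def by blast
  \<comment> \<open>Abel's identity: the Wronskian of two Kummer solutions is a multiple of
    \<open>t powr (- c) * exp t\<close>, so this weight makes it constant.\<close>
  define W where "W t = (v' t * u t - v t * u' t) * (t powr c * exp (- t))" for t
  have "\<exists>C. \<forall>t\<in>{0<..}. W t = C"
  proof (rule has_field_derivative_zero_constant)
    fix t :: real assume "t \<in> {0<..}"
    then have t: "t > 0" by simp
    have "(W has_real_derivative (v'' t * u t - v t * u'' t) * (t powr c * exp (- t))
        + (v' t * u t - v t * u' t) * (c * t powr (c - 1) * exp (- t) - t powr c * exp (- t))) (at t)"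
      unfolding W_def using t u(1,2)[OF t] v(1,2)[OF t]
      by (auto intro!: derivative_eq_intros simp: algebra_simps)
    moreover have "(v'' t * u t - v t * u'' t) * (t powr c * exp (- t))
        + (v' t * u t - v t * u' t) * (c * t powr (c - 1) * exp (- t) - t powr c * exp (- t))
        = (u t * (t * v'' t + (c - t) * v' t - a * v t) - v t * (t * u'' t + (c - t) * u' t - a * u t))
          * (t powr (c - 1) * exp (- t))"
      using t powr_add[of t "c - 1" 1] by (simp add: algebra_simps)
    ultimately have "(W has_real_derivative 0) (at t)"
      using u(3)[OF t] v(3)[OF t] by simp
    then show "(W has_real_derivative 0) (at t within {0<..})"
      by (rule has_field_derivative_at_within)
  qed simp
  then obtain C where C: "W t = C" if "t > 0" for t by auto
  define r where "r t = v t / u t" for t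
  have r': "(r has_real_derivative C * (t powr (2 * a - c) * exp t) / (t powr a * u t)\<^sup>2) (at t)"
    if t: "t > 0" for t
  proof -
    have "v' t * u t - v t * u' t = C * (t powr (- c) * exp t)"
      using C[OF t] t by (auto simp: W_def powr_minus exp_minus field_simps)
    moreover have "(r has_real_derivative (v' t * u t - v t * u' t) / (u t)\<^sup>2) (at t)"
      unfolding r_def using u(1)[OF t] v(1)[OF t] pos[OF t]
      by (auto intro!: derivative_eq_intros simp: power2_eq_square)
    moreover have "t powr (2 * a - c) = t powr (- c) * (t powr a)\<^sup>2"
      using t by (simp add: powr_power powr_add[symmetric])
    ultimately show ?thesis using t by (simp add: power_mult_distrib)
  qed
  have "((\<lambda>t. (t powr a * v t) / (t powr a * u t)) \<longlongrightarrow> 1 / 1) at_top"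
    by (intro tendsto_divide lim_u lim_v) simp
  moreover have "\<forall>\<^sub>F t in at_top. (t powr a * v t) / (t powr a * u t) = r t"
    using eventually_gt_at_top[of 0] by eventually_elim (simp add: r_def)
  ultimately have lim_r: "(r \<longlongrightarrow> 1) at_top"
    by (simp add: Lim_transform_eventually)
  have "C = 0"
  proof (rule ccontr)
    assume "C \<noteq> 0"
    \<comment> \<open>Eventually \<open>(t powr a * u t)\<^sup>2 \<le> 4\<close>, so the numerator
      bound 4 makes the derivative of \<open>r\<close> at least 1 in absolute value. Then
      \<open>r\<close> changes by at least 1 from \<open>N\<close> to \<open>N + 1\<close>, although
      both values lie within 1/2 of 1.\<close>
    have "filterlim (\<lambda>t::real. t powr (2 * a - c) * exp t) at_top at_top" by real_asymp
    then have "\<forall>\<^sub>F t in at_top. 4 / \<bar>C\<bar> \<le> t powr (2 * a - c) * exp t"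
      by (simp add: filterlim_at_top)
    moreover have "\<forall>\<^sub>F t in at_top. \<bar>t powr a * u t\<bar> < 2"
      by (rule order_tendstoD(2)[OF tendsto_rabs[OF lim_u]]) simp
    moreover have "\<forall>\<^sub>F t in at_top. \<bar>r t - 1\<bar> < 1 / 2"
      by (rule order_tendstoD(2)[of _ 0]) (use lim_r in \<open>auto intro!: tendsto_eq_intros\<close>)
    ultimately have "\<forall>\<^sub>F t in at_top. 4 / \<bar>C\<bar> \<le> t powr (2 * a - c) * exp t
        \<and> \<bar>t powr a * u t\<bar> < 2 \<and> \<bar>r t - 1\<bar> < 1 / 2 \<and> t > 0"
      using eventually_gt_at_top[of 0] by eventually_elim auto
    then obtain N where N: "4 / \<bar>C\<bar> \<le> t powr (2 * a - c) * exp t"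
        "\<bar>t powr a * u t\<bar> < 2" "\<bar>r t - 1\<bar> < 1 / 2" "t > 0" if "t \<ge> N" for t
      unfolding eventually_at_top_linorder by blast
    have "\<exists>z>N. z < N + 1 \<and> r (N + 1) - r N
        = (N + 1 - N) * (C * (z powr (2 * a - c) * exp z) / (z powr a * u z)\<^sup>2)"
      by (rule MVT2) (use N(4) r' in auto)
    then obtain z where z: "z > N"
        "r (N + 1) - r N = C * (z powr (2 * a - c) * exp z) / (z powr a * u z)\<^sup>2" by auto
    have "z > 0" using N(4)[of z] z by simp
    have "0 < z powr a * u z" using pos[OF \<open>z > 0\<close>] \<open>z > 0\<close> by simp
    moreover have "(z powr a * u z)\<^sup>2 \<le> 2\<^sup>2"
      using N(2)[of z] z by (intro power2_le_iff_abs_le[THEN iffD2]) auto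
    moreover have "4 \<le> \<bar>C\<bar> * (z powr (2 * a - c) * exp z)"
      using N(1)[of z] z \<open>C \<noteq> 0\<close> by (simp add: field_simps)
    ultimately have "1 \<le> \<bar>r (N + 1) - r N\<bar>"
      unfolding z(2) using \<open>z > 0\<close> pos[of z] by (simp add: abs_mult abs_divide le_divide_eq)
    then show False using N(3)[of N] N(3)[of "N + 1"] by (simp add: abs_if split: if_splits)
  qed
  have "\<exists>k. \<forall>t\<in>{0<..}. r t = k"
    by (rule has_field_derivative_zero_constant)
      (use r' \<open>C = 0\<close> in \<open>auto intro: has_field_derivative_at_within\<close>)
  then obtain k where k: "r t = k" if "t > 0" for t by auto
  have "\<forall>\<^sub>F t in at_top. r t = k"
    using eventually_gt_at_top[of 0] by eventually_elim (rule k)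
  then have "(r \<longlongrightarrow> k) at_top" by (rule tendsto_eventually)
  then have "k = 1" using lim_r by (auto intro: tendsto_unique[OF trivial_limit_at_top_linorder])
  then show ?thesis using k[OF x] pos[OF x] by (simp add: r_def)
qed

section \<open>Integral representations of the Tricomi function and its lower neighbour\<close>

lemma tricomi_eqI:
  assumes "kummer_solution a c y" "\<And>t. t > 0 \<Longrightarrow> y t > 0"
    "((\<lambda>t. t powr a * y t) \<longlongrightarrow> 1) at_top" "x > 0"
  shows "tricomi a c x = y x"
  unfolding tricomi_def
  by (rule the_equality) (use assms kummer_solution_unique in blast)+

lemma tricomi_eq_integral:
  assumes "a > 0" "c \<le> a + 1" "x > 0"
  shows "tricomi a c x = tricomi_int a (c - a - 1) x / Gamma a"
proof (rule tricomi_eqI)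
  have e: "c - a - 1 \<le> 0" using assms by simp
  have G: "Gamma a > 0" using assms by (simp add: Gamma_real_pos)
  show "kummer_solution a c (\<lambda>x. tricomi_int a (c - a - 1) x / Gamma a)"
    unfolding kummer_solution_def
  proof (intro exI allI impI conjI)
    fix x :: real assume x: "x > 0"
    show "((\<lambda>x. tricomi_int a (c - a - 1) x / Gamma a) has_real_derivative
        - tricomi_int (a + 1) (c - a - 1) x / Gamma a) (at x)"
      using tricomi_int_has_derivative[OF assms(1) e x] by (rule DERIV_cdivide)
    have "(tricomi_int (a + 1) (c - a - 1) has_real_derivative - tricomi_int (a + 2) (c - a - 1) x) (at x)"
      using tricomi_int_has_derivative[of "a + 1", OF _ e x] assms by (simp add: add.assoc)
    then show "((\<lambda>x. - tricomi_int (a + 1) (c - a - 1) x / Gamma a) has_real_derivative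
        tricomi_int (a + 2) (c - a - 1) x / Gamma a) (at x)"
      using G by (auto intro!: derivative_eq_intros)
    have "x * tricomi_int (a + 2) (c - a - 1) x
        + (c - x) * (- tricomi_int (a + 1) (c - a - 1) x) - a * tricomi_int a (c - a - 1) x = 0"
      using tricomi_int_kummer[OF assms(1) e x] by (simp add: algebra_simps)
    then have "(x * tricomi_int (a + 2) (c - a - 1) x
        + (c - x) * (- tricomi_int (a + 1) (c - a - 1) x) - a * tricomi_int a (c - a - 1) x) / Gamma a = 0"
      by simp
    then show "x * (tricomi_int (a + 2) (c - a - 1) x / Gamma a)
        + (c - x) * (- tricomi_int (a + 1) (c - a - 1) x / Gamma a)
        - a * (tricomi_int a (c - a - 1) x / Gamma a) = 0"
      by (simp add: diff_divide_distrib add_divide_distrib)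
  qed
  show "tricomi_int a (c - a - 1) t / Gamma a > 0" if "t > 0" for t
    using tricomi_int_pos[OF assms(1) e that] G by simp
  have "((\<lambda>t. t powr a * tricomi_int a (c - a - 1) t / Gamma a) \<longlongrightarrow> Gamma a / Gamma a) at_top"
    by (intro tendsto_intros tricomi_int_asymp e assms) (use G in simp)
  then show "((\<lambda>t. t powr a * (tricomi_int a (c - a - 1) t / Gamma a)) \<longlongrightarrow> 1) at_top"
    using G by simp
qed fact

text \<open>By Kummer's equation for \<open>tricomi a c\<close>, the derivative of the candidate
  collapses to \<open>(1 - a)\<close> times that function. Its own Kummer equation therefore
  contains only the two integrals from which the candidate is built, and reduces to an algebraic
  identity.\<close>

lemma tricomi_shift_down_eq_integral:
  assumes "a > 0" "c \<le> 1" "x > 0"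
  shows "tricomi (a - 1) (c - 1) x
    = ((x + 1 - c) * tricomi_int a (c - a - 1) x + x * tricomi_int (a + 1) (c - a - 1) x) / Gamma a"
proof (rule tricomi_eqI)
  define I where "I s = tricomi_int s (c - a - 1)" for s
  have e: "c - a - 1 \<le> 0" using assms by simp
  have I': "(I a has_real_derivative - I (a + 1) x) (at x)"
    "(I (a + 1) has_real_derivative - I (a + 2) x) (at x)"
    "x * I (a + 2) x = a * I a x + (c - x) * I (a + 1) x" if "x > 0" for x
    using tricomi_int_has_derivative[OF assms(1) e that]
      tricomi_int_has_derivative[of "a + 1", OF _ e that]
      tricomi_int_kummer[OF assms(1) e that] assms
    by (simp_all add: I_def add.assoc)
  have G: "Gamma a > 0" using assms by (simp add: Gamma_real_pos)
  have "kummer_solution (a - 1) (c - 1) (\<lambda>x. ((x + 1 - c) * I a x + x * I (a + 1) x) / Gamma a)"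
    unfolding kummer_solution_def
  proof (intro exI allI impI conjI)
    fix x :: real assume x: "x > 0"
    have "((\<lambda>x. ((x + 1 - c) * I a x + x * I (a + 1) x) / Gamma a) has_real_derivative
        (I a x + (x + 1 - c) * (- I (a + 1) x) + I (a + 1) x + x * (- I (a + 2) x)) / Gamma a) (at x)"
      using I'(1,2)[OF x] G by (auto intro!: derivative_eq_intros)
    moreover have "I a x + (x + 1 - c) * (- I (a + 1) x) + I (a + 1) x + x * (- I (a + 2) x) = (1 - a) * I a x"
      using I'(3)[OF x] by (simp add: algebra_simps)
    ultimately show "((\<lambda>x. ((x + 1 - c) * I a x + x * I (a + 1) x) / Gamma a) has_real_derivative
        (1 - a) * I a x / Gamma a) (at x)"
      by simp
    show "((\<lambda>x. (1 - a) * I a x / Gamma a) has_real_derivative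
        (1 - a) * (- I (a + 1) x) / Gamma a) (at x)"
      using I'(1)[OF x] G by (auto intro!: derivative_eq_intros)
    show "x * ((1 - a) * (- I (a + 1) x) / Gamma a) + (c - 1 - x) * ((1 - a) * I a x / Gamma a)
        - (a - 1) * (((x + 1 - c) * I a x + x * I (a + 1) x) / Gamma a) = 0"
      using G by (simp add: divide_simps) (simp add: algebra_simps)
  qed
  then show "kummer_solution (a - 1) (c - 1) (\<lambda>x. ((x + 1 - c) * tricomi_int a (c - a - 1) x
      + x * tricomi_int (a + 1) (c - a - 1) x) / Gamma a)"
    by (simp add: I_def)
  show "((t + 1 - c) * tricomi_int a (c - a - 1) t + t * tricomi_int (a + 1) (c - a - 1) t) / Gamma a > 0"
    if "t > 0" for t
    using tricomi_int_pos[OF assms(1) e that] tricomi_int_pos[of "a + 1", OF _ e that] assms that G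
    by (intro divide_pos_pos add_pos_pos mult_pos_pos) auto
  \<comment> \<open>Each integral is paired with the power of \<open>t\<close> that normalises it.
    What is left over is a factor tending to 1 for the first integral and a factor
    \<open>1 / t\<close> for the second.\<close>
  have "((\<lambda>t. ((1 + (1 - c) / t) * (t powr a * I a t) + (t powr (a + 1) * I (a + 1) t) / t) / Gamma a)
      \<longlongrightarrow> ((1 + 0) * Gamma a + 0) / Gamma a) at_top"
    unfolding I_def
    by (intro tendsto_intros tricomi_int_asymp e tendsto_divide_0[OF tricomi_int_asymp] tendsto_divide_0[OF tendsto_const]
        filterlim_at_top_imp_at_infinity filterlim_ident) (use G assms(1) in \<open>simp_all add: less_imp_neq[THEN not_sym]\<close>)
  moreover have "\<forall>\<^sub>F t in at_top. ((1 + (1 - c) / t) * (t powr a * I a t) + (t powr (a + 1) * I (a + 1) t) / t) / Gamma a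
      = t powr (a - 1) * (((t + 1 - c) * I a t + t * I (a + 1) t) / Gamma a)"
    using eventually_gt_at_top[of 0]
  proof eventually_elim
    case (elim t)
    have "t powr a = t powr (a - 1) * t" "t powr (a + 1) = t powr (a - 1) * t * t"
      using elim powr_add[of t "a - 1" 1] powr_add[of t a 1] by auto
    then show ?case using elim G by (simp add: field_simps)
  qed
  ultimately show "((\<lambda>t. t powr (a - 1) * (((t + 1 - c) * tricomi_int a (c - a - 1) t
      + t * tricomi_int (a + 1) (c - a - 1) t) / Gamma a)) \<longlongrightarrow> 1) at_top"
    using G by (simp add: I_def Lim_transform_eventually)
qed fact

section \<open>The Riccati equation of the logarithmic derivative\<close>

text \<open>At the last point of \<open>[x0, x]\<close> where \<open>F\<close> is nonnegative, a
  positive derivative would produce a later such point. Applied to a function minus a threshold,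
  this says that a bound once violated stays violated.\<close>

lemma nonneg_barrier:
  fixes F F' :: "real \<Rightarrow> real"
  assumes deriv: "\<And>t. t \<ge> x0 \<Longrightarrow> (F has_real_derivative F' t) (at t)"
    and init: "F x0 \<ge> 0"
    and incr: "\<And>t. t \<ge> x0 \<Longrightarrow> F t \<ge> 0 \<Longrightarrow> F' t > 0"
    and x: "x \<ge> x0"
  shows "F x \<ge> 0"
proof (rule ccontr)
  assume neg: "\<not> F x \<ge> 0"
  define S where "S = {t \<in> {x0..x}. F t \<ge> 0}"
  have "continuous_on {x0..x} F"
    by (intro continuous_at_imp_continuous_on ballI DERIV_isCont[OF deriv]) auto
  then have "closed S"
    unfolding S_def by (intro continuous_on_closed_Collect_le) auto
  moreover have "bounded S"
    by (rule bounded_subset[of "{x0..x}"]) (auto simp: S_def)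
  ultimately have "compact S" by (simp add: compact_eq_bounded_closed)
  moreover have "x0 \<in> S" using init x by (simp add: S_def)
  ultimately obtain s where s: "s \<in> S" "\<And>t. t \<in> S \<Longrightarrow> t \<le> s"
    using compact_attains_sup[of S] by blast
  have sx: "x0 \<le> s" "F s \<ge> 0" "s < x" using s(1) neg by (auto simp: S_def order_less_le)
  obtain d where d: "d > 0" "\<And>h. h > 0 \<Longrightarrow> h < d \<Longrightarrow> F s < F (s + h)"
    using DERIV_pos_inc_right[OF deriv[OF sx(1)] incr[OF sx(1,2)]] by blast
  define h where "h = min (d / 2) (x - s)"
  have h: "h > 0" "h < d" "s + h \<le> x" using d sx by (auto simp: h_def)
  then have "s + h \<in> S" using d(2)[of h] sx by (auto simp: S_def)
  then show False using s(2) h by fastforce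
qed

text \<open>The equation for \<open>h\<close> controls \<open>t * h' t\<close>, so a constant bound
  on it yields only the rate \<open>\<delta> / t\<close>; the integral of this rate still
  diverges.\<close>

lemma log_growth_unbounded:
  fixes f f' :: "real \<Rightarrow> real"
  assumes deriv: "\<And>t. t \<ge> x0 \<Longrightarrow> (f has_real_derivative f' t) (at t)"
    and x0: "x0 > 0" and \<delta>: "\<delta> > 0"
    and growth: "\<And>t. t \<ge> x0 \<Longrightarrow> f' t \<ge> \<delta> / t"
  obtains x where "x \<ge> x0" "f x > M"
proof -
  have "filterlim (\<lambda>t. f x0 + \<delta> * (ln t - ln x0)) at_top at_top"
    using \<delta> by real_asymp
  then have "\<forall>\<^sub>F t in at_top. M < f x0 + \<delta> * (ln t - ln x0) \<and> t \<ge> x0"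
    by (intro eventually_conj) (auto simp: filterlim_at_top_dense eventually_ge_at_top)
  then obtain x where x: "M < f x0 + \<delta> * (ln x - ln x0)" "x \<ge> x0"
    using eventually_happens by fastforce
  have "f x0 - \<delta> * ln x0 \<le> f x - \<delta> * ln x"
  proof (rule DERIV_nonneg_imp_nondecreasing[OF x(2)])
    fix t assume "x0 \<le> t"
    then show "\<exists>y. ((\<lambda>t. f t - \<delta> * ln t) has_real_derivative y) (at t) \<and> y \<ge> 0"
      using deriv[of t] growth[of t] x0
      by (intro exI[of _ "f' t - \<delta> / t"]) (auto intro!: derivative_eq_intros)
  qed
  with x that show ?thesis by (simp add: algebra_simps)
qed

text \<open>The Riccati equation is shared by all positive Kummer solutions. What distinguishes the
  Tricomi function are the bounds on \<open>h\<close>, which hold up to infinity and on which every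
  contradiction below rests. Here \<open>b\<close> is \<open>1 - c\<close>.\<close>

locale tricomi_riccati =
  fixes a b :: real and h :: "real \<Rightarrow> real"
  assumes a: "a > 0" and b: "b > 0"
    and h_pos: "x > 0 \<Longrightarrow> h x > 0"
    and h_less: "x > 0 \<Longrightarrow> h x < a"
    and h_le: "x > 0 \<Longrightarrow> h x * (x + b - 1) < a * x"
    and h_deriv: "x > 0 \<Longrightarrow> (h has_real_derivative ((h x)\<^sup>2 + (x + b) * h x - a * x) / x) (at x)"
begin

definition g where "g x = (h x)\<^sup>2 + (x + b) * h x - a * x"

lemma g_deriv: "x > 0 \<Longrightarrow> (g has_real_derivative ((2 * h x + x + b) * g x + x * (h x - a)) / x) (at x)"
  unfolding g_def using h_deriv[of x]
  by (auto intro!: derivative_eq_intros simp: field_simps power2_eq_square)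

lemma g_not_bounded_below:
  assumes "x0 > 0" "\<delta> > 0" "\<And>t. t \<ge> x0 \<Longrightarrow> g t \<ge> \<delta>"
  shows False
proof (rule log_growth_unbounded[of x0 h "\<lambda>t. g t / t" \<delta> a])
  show "(h has_real_derivative g t / t) (at t)" if "t \<ge> x0" for t
    using h_deriv[of t] that assms by (simp add: g_def)
  show "\<delta> / t \<le> g t / t" if "t \<ge> x0" for t
    using assms that by (intro divide_right_mono) auto
  show False if "x \<ge> x0" "h x > a" for x using h_less[of x] that assms by simp
qed fact+

lemma g_not_bounded_above:
  assumes "x0 > 0" "\<delta> > 0" "\<And>t. t \<ge> x0 \<Longrightarrow> g t \<le> - \<delta>"
  shows False
proof (rule log_growth_unbounded[of x0 "\<lambda>t. - h t" "\<lambda>t. - (g t / t)" \<delta> 0])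
  show "((\<lambda>t. - h t) has_real_derivative - (g t / t)) (at t)" if "t \<ge> x0" for t
    using h_deriv[of t] that assms by (auto simp: g_def intro!: derivative_eq_intros)
  show "\<delta> / t \<le> - (g t / t)" if "t \<ge> x0" for t
    using assms(1) assms(3)[OF that] that by (simp add: field_simps)
  show False if "x \<ge> x0" "- h x > 0" for x using h_pos[of x] that assms by simp
qed fact+

text \<open>Where \<open>g \<le> 0\<close>, the first summand of \<open>t * g' t\<close> is at most
  0 and the second, \<open>t * (h t - a)\<close>, is negative. So \<open>g\<close> would keep
  decreasing and \<open>h\<close> would become negative.\<close>

lemma g_pos:
  assumes x: "x > 0"
  shows "g x > 0"
proof (rule ccontr)
  assume neg: "\<not> g x > 0"
  let ?g' = "\<lambda>t. ((2 * h t + t + b) * g t + t * (h t - a)) / t"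
  have g'_neg: "?g' t < 0" if "t \<ge> x" "g t \<le> 0" for t
  proof -
    have "(2 * h t + t + b) * g t \<le> 0"
      using that x h_pos[of t] b by (intro mult_nonneg_nonpos) auto
    moreover have "t * (h t - a) < 0"
      using that x h_less[of t] by (intro mult_pos_neg) auto
    ultimately show ?thesis using that x by (intro divide_neg_pos) auto
  qed
  have nonpos: "g t \<le> 0" if "t \<ge> x" for t
    using nonneg_barrier[of x "\<lambda>t. - g t" "\<lambda>t. - ?g' t" t] g_deriv g'_neg that x neg
    by (force intro!: derivative_intros)
  \<comment> \<open>The value \<open>g x\<close> may be 0; one unit to the right \<open>g\<close> is
    strictly negative, which supplies the margin for \<open>g_not_bounded_above\<close>.\<close>
  have "g (x + 1) < g x"
    by (rule DERIV_neg_imp_decreasing[of x "x + 1" g])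
      (use x in \<open>auto intro!: exI conjI g_deriv g'_neg nonpos\<close>)
  have "g t \<le> g (x + 1)" if "t \<ge> x + 1" for t
    by (rule DERIV_nonpos_imp_nonincreasing[OF that])
      (use x in \<open>auto intro!: exI conjI g_deriv less_imp_le[OF g'_neg] nonpos\<close>)
  then show False
    using g_not_bounded_above[of "x + 1" "- g (x + 1)"] \<open>g (x + 1) < g x\<close> neg x by force
qed

text \<open>After \<open>t * (h t - a)\<close> is eliminated through the definition of
  \<open>g\<close>, the only negative term in \<open>t * g' t\<close> is
  \<open>- h t * (h t + b)\<close>, which exceeds \<open>- a * (a + b)\<close> because
  \<open>h < a\<close>. Hence \<open>g\<close> increases wherever \<open>t * g t\<close> is at least
  that constant.\<close>

lemma g_less_quotient:
  assumes x: "x > 0"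
  shows "g x < a * (a + b) / x"
proof (rule ccontr)
  assume neg: "\<not> g x < a * (a + b) / x"
  let ?g' = "\<lambda>t. ((2 * h t + t + b) * g t + t * (h t - a)) / t"
  have g'_pos: "?g' t > 0" if "t \<ge> x" "g t \<ge> a * (a + b) / t" for t
  proof -
    have t: "t > 0" using that x by simp
    have "(2 * h t + t + b) * g t + t * (h t - a) = (2 * h t + b + 1) * g t + (t * g t - h t * (h t + b))"
      by (simp add: g_def algebra_simps power2_eq_square)
    moreover have "(2 * h t + b + 1) * g t > 0"
      using h_pos[OF t] g_pos[OF t] b by simp
    moreover have "h t * (h t + b) < a * (a + b)"
      using h_pos[OF t] h_less[OF t] b by (intro mult_strict_mono) auto
    moreover have "a * (a + b) \<le> t * g t"
      using that t by (simp add: field_simps)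
    ultimately have "(2 * h t + t + b) * g t + t * (h t - a) > 0" by linarith
    then show ?thesis using t by simp
  qed
  have ge: "g t \<ge> a * (a + b) / t" if "t \<ge> x" for t
  proof -
    have "0 \<le> g t - a * (a + b) / t"
    proof (rule nonneg_barrier[of x "\<lambda>t. g t - a * (a + b) / t" "\<lambda>t. ?g' t + a * (a + b) / t\<^sup>2"])
      show "((\<lambda>t. g t - a * (a + b) / t) has_real_derivative ?g' t + a * (a + b) / t\<^sup>2) (at t)"
        if "t \<ge> x" for t
        using g_deriv[of t] that x by (auto intro!: derivative_eq_intros simp: power2_eq_square)
      show "?g' t + a * (a + b) / t\<^sup>2 > 0" if "t \<ge> x" "0 \<le> g t - a * (a + b) / t" for t
        using g'_pos[of t] that a b by (intro add_pos_nonneg) auto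
    qed (use neg that in auto)
    then show ?thesis by simp
  qed
  \<comment> \<open>The threshold tends to 0 and gives no uniform lower bound; monotonicity provides
    one, namely \<open>g x\<close>.\<close>
  have "g x \<le> g t" if "t \<ge> x" for t
    by (rule DERIV_nonneg_imp_nondecreasing[OF that])
      (use x in \<open>auto intro!: exI conjI g_deriv less_imp_le[OF g'_pos] ge\<close>)
  then show False using g_not_bounded_below[of x "g x"] g_pos x by blast
qed

text \<open>With \<open>g \<ge> a / 2\<close> the term \<open>2 * h * g\<close> is at least
  \<open>a * h\<close> and outweighs the square of \<open>h\<close>. It remains to compare
  \<open>h * b\<close> with \<open>a * (t + b + 1) / 2\<close>.\<close>

lemma g_less_half:
  assumes x: "x > 0"
  shows "g x < a / 2"
proof (rule ccontr)
  assume neg: "\<not> g x < a / 2"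
  let ?g' = "\<lambda>t. ((2 * h t + t + b) * g t + t * (h t - a)) / t"
  have g'_pos: "?g' t > 0" if "t \<ge> x" "g t \<ge> a / 2" for t
  proof -
    have t: "t > 0" using that x by simp
    \<comment> \<open>For \<open>b \<le> 1\<close> the bound \<open>h < a\<close> is enough. For
      \<open>b > 1\<close> the factor \<open>t + b - 1\<close> is positive, and \<open>h_le\<close>
      reduces the claim to \<open>2 * t * b \<le> (t + b)\<^sup>2 - 1\<close>, that is, to
      \<open>1 \<le> b\<^sup>2 + t\<^sup>2\<close>.\<close>
    have hb: "h t * b < a * (t + b + 1) / 2"
    proof (cases "b \<le> 1")
      case True
      then have "h t * b < a * b" "b \<le> (t + b + 1) / 2" using h_less[OF t] b t by auto
      moreover have "a * b \<le> a * ((t + b + 1) / 2)"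
        using a calculation by (intro mult_left_mono) auto
      ultimately show ?thesis by simp
    next
      case False
      have "h t * b * (t + b - 1) < a * t * b"
        using mult_strict_right_mono[OF h_le[OF t] b] by (simp add: mult_ac)
      also have "a * t * b \<le> a * ((t + b + 1) / 2 * (t + b - 1))"
      proof -
        have "1 \<le> b\<^sup>2 + t\<^sup>2" using False by (intro add_increasing2) (auto simp: one_le_power)
        then have "t * b \<le> (t + b + 1) / 2 * (t + b - 1)"
          by (simp add: field_simps power2_eq_square)
        then show ?thesis using a by (simp add: mult.assoc mult_left_mono)
      qed
      also have "\<dots> = a * (t + b + 1) / 2 * (t + b - 1)" by simp
      finally show ?thesis using False t by (simp add: mult_less_cancel_right)
    qed
    have "(2 * h t + t + b) * g t + t * (h t - a) = (2 * h t + t + b + 1) * g t - h t * (h t + b)"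
      by (simp add: g_def algebra_simps power2_eq_square)
    moreover have "(2 * h t + t + b + 1) * g t \<ge> (2 * h t + t + b + 1) * (a / 2)"
      using that h_pos[OF t] t b by (intro mult_left_mono) auto
    moreover have "h t * (a - h t) > 0" using h_pos[OF t] h_less[OF t] by simp
    ultimately have "(2 * h t + t + b) * g t + t * (h t - a) > 0"
      using hb by (simp add: field_simps)
    then show ?thesis using t by simp
  qed
  have "0 \<le> g t - a / 2" if "t \<ge> x" for t
    by (rule nonneg_barrier[of x "\<lambda>t. g t - a / 2" ?g'])
      (use g_deriv g'_pos that x neg in \<open>auto intro!: derivative_eq_intros\<close>)
  then show False using g_not_bounded_below[of x "a / 2"] a x by auto
qed

end

section \<open>The second derivative of \<open>h\<close> and the behaviour at 0, for
  \<open>b > 2\<close>\<close>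

locale tricomi_riccati_large = tricomi_riccati +
  assumes b_gt_2: "b > 2"
begin

definition p where "p x = g x / x"

text \<open>The second derivative of \<open>h\<close>, with \<open>p\<close> the first. In the
  equation for \<open>q\<close> the constant part of the coefficient has dropped to
  \<open>b - 2\<close>, whence the restriction on \<open>b\<close>.\<close>

definition q where "q x = ((2 * h x + x + b - 1) * p x + h x - a) / x"

lemma h_deriv_p: "x > 0 \<Longrightarrow> (h has_real_derivative p x) (at x)"
  using h_deriv[of x] by (simp add: p_def g_def)

lemma p_deriv: "x > 0 \<Longrightarrow> (p has_real_derivative q x) (at x)"
  unfolding p_def q_def using g_deriv[of x]
  by (auto intro!: derivative_eq_intros simp: field_simps)

lemma q_deriv:
  "x > 0 \<Longrightarrow> (q has_real_derivative ((2 * h x + x + b - 2) * q x + 2 * (p x)\<^sup>2 + 2 * p x) / x) (at x)"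
  unfolding q_def using h_deriv_p[of x] p_deriv[of x]
  by (auto intro!: derivative_eq_intros simp: q_def field_simps power2_eq_square)

lemma p_pos: "x > 0 \<Longrightarrow> p x > 0"
  using g_pos by (simp add: p_def)

lemma p_not_bounded_below:
  assumes "x0 > 0" "\<delta> > 0" "\<And>t. t \<ge> x0 \<Longrightarrow> p t \<ge> \<delta>"
  shows False
proof (rule g_not_bounded_below[of x0 "x0 * \<delta>"])
  fix t assume "t \<ge> x0"
  then have "x0 * \<delta> \<le> t * p t" using assms by (intro mult_mono) auto
  then show "x0 * \<delta> \<le> g t" using \<open>t \<ge> x0\<close> assms by (simp add: p_def)
qed (use assms in auto)

text \<open>The threshold is the value of \<open>p\<close> at which the numerator of
  \<open>q\<close> vanishes for \<open>x = 0\<close> and \<open>h = 0\<close>. For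
  \<open>x > 0\<close> the additional terms \<open>(2 * h x + x) * p x\<close> and
  \<open>h x\<close> are positive and push \<open>p\<close> further up.\<close>

lemma p_less:
  assumes x: "x > 0"
  shows "p x < a / (b - 1)"
proof (rule ccontr)
  assume neg: "\<not> p x < a / (b - 1)"
  define k where "k = a / (b - 1)"
  have k: "k > 0" "(b - 1) * k = a" using a b_gt_2 by (auto simp: k_def)
  have q_pos: "q t > 0" if "t \<ge> x" "p t \<ge> k" for t
  proof -
    have t: "t > 0" using that x by simp
    have "(2 * h t + t + b - 1) * k \<le> (2 * h t + t + b - 1) * p t"
      using that t h_pos[OF t] b_gt_2 by (intro mult_left_mono) auto
    moreover have "(2 * h t + t) * k > 0" using t h_pos[OF t] k by simp
    ultimately have "(2 * h t + t + b - 1) * p t + h t - a > 0"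
      using k h_pos[OF t] by (simp add: algebra_simps)
    then show ?thesis using t by (simp add: q_def)
  qed
  have "0 \<le> p t - k" if "t \<ge> x" for t
    by (rule nonneg_barrier[of x "\<lambda>t. p t - k" q])
      (use p_deriv q_pos that x neg in \<open>auto intro!: derivative_eq_intros simp: k_def\<close>)
  then show False using p_not_bounded_below[of x k] k x by auto
qed

text \<open>The terms with \<open>p\<close> in the equation for \<open>q\<close> are positive, so
  \<open>q \<ge> 0\<close> would persist. Then \<open>p\<close>, the derivative of \<open>h\<close>,
  would stay above a positive constant and \<open>h\<close> would be unbounded.\<close>

lemma q_neg:
  assumes x: "x > 0"
  shows "q x < 0"
proof (rule ccontr)
  assume neg: "\<not> q x < 0"
  have q_nonneg: "0 \<le> q t" if "t \<ge> x" for t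
  proof (rule nonneg_barrier[of x q "\<lambda>t. ((2 * h t + t + b - 2) * q t + 2 * (p t)\<^sup>2 + 2 * p t) / t"])
    fix t assume "t \<ge> x" "0 \<le> q t"
    then show "((2 * h t + t + b - 2) * q t + 2 * (p t)\<^sup>2 + 2 * p t) / t > 0"
      using x h_pos[of t] p_pos[of t] b_gt_2
      by (intro divide_pos_pos add_nonneg_pos mult_nonneg_nonneg add_nonneg_nonneg) auto
  qed (use q_deriv that x neg in auto)
  have "p x \<le> p t" if "t \<ge> x" for t
    by (rule DERIV_nonneg_imp_nondecreasing[OF that]) (use q_nonneg x in \<open>auto intro!: exI conjI p_deriv\<close>)
  then show False using p_not_bounded_below[of x "p x"] p_pos x by blast
qed

text \<open>\<open>2 * m\<close> is the value of \<open>q\<close> at which the right-hand side of \<open>q_deriv\<close>, times \<open>x\<close>, vanishes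
  at \<open>x = 0\<close>, where \<open>h = 0\<close> and \<open>p = a / (b - 1)\<close>.\<close>

definition m where "m = - (a * (a + b - 1)) / ((b - 1)\<^sup>2 * (b - 2))"

text \<open>At \<open>q = 2 * m\<close> the term \<open>(b - 2) * q\<close> balances
  \<open>2 * k * (k + 1)\<close>, which bounds the terms with \<open>p\<close> because
  \<open>p < k\<close>; the rest, \<open>(2 * h + x) * q\<close>, is negative. So \<open>q\<close>
  would stay at or below \<open>2 * m\<close> and \<open>p\<close> would become negative.\<close>

lemma q_greater:
  assumes x: "x > 0"
  shows "q x > 2 * m"
proof (rule ccontr)
  assume neg: "\<not> q x > 2 * m"
  define k where "k = a / (b - 1)"
  have k: "k > 0" using a b_gt_2 by (simp add: k_def)
  have "k * (k + 1) = a * (a + b - 1) / (b - 1)\<^sup>2"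
    using b_gt_2 by (simp add: k_def field_simps power2_eq_square)
  then have mk: "m * (b - 2) = - (k * (k + 1))"
    using b_gt_2 by (simp add: m_def)
  have m_neg: "m < 0"
    using k b_gt_2 mk by (smt (verit) mult_pos_pos zero_le_mult_iff)
  have q'_neg: "((2 * h t + t + b - 2) * q t + 2 * (p t)\<^sup>2 + 2 * p t) / t < 0"
    if "t \<ge> x" "q t \<le> 2 * m" for t
  proof -
    have t: "t > 0" using that x by simp
    have p: "p t < k" "p t > 0" using p_less[OF t] p_pos[OF t] by (auto simp: k_def)
    have "(2 * h t + t + b - 2) * q t \<le> (2 * h t + t + b - 2) * (2 * m)"
      using that t h_pos[OF t] b_gt_2 by (intro mult_left_mono) auto
    moreover have "(2 * h t + t) * (2 * m) < 0"
      using t h_pos[OF t] m_neg by (intro mult_pos_neg) auto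
    moreover have "p t * (p t + 1) < k * (k + 1)"
      using p by (intro mult_strict_mono) auto
    ultimately have "(2 * h t + t + b - 2) * q t + 2 * (p t)\<^sup>2 + 2 * p t < 0"
      using mk by (simp add: algebra_simps power2_eq_square)
    then show ?thesis using t by (simp add: divide_neg_pos)
  qed
  have le: "0 \<le> 2 * m - q t" if "t \<ge> x" for t
    by (rule nonneg_barrier[of x "\<lambda>t. 2 * m - q t"
          "\<lambda>t. - (((2 * h t + t + b - 2) * q t + 2 * (p t)\<^sup>2 + 2 * p t) / t)"])
      (use q_deriv q'_neg that x neg in \<open>force intro!: derivative_eq_intros\<close>)+
  show False
  proof (rule log_growth_unbounded[of x "\<lambda>t. - p t" "\<lambda>t. - q t" "- 2 * m * x" 0])
    show "((\<lambda>t. - p t) has_real_derivative - q t) (at t)" if "t \<ge> x" for t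
      using p_deriv[of t] that x by (auto intro!: derivative_eq_intros)
    show "- 2 * m * x > 0" using m_neg x by (simp add: mult_neg_pos)
    show "- 2 * m * x / t \<le> - q t" if "t \<ge> x" for t
    proof -
      \<comment> \<open>The decrease of \<open>p\<close> is bounded below by the constant
        \<open>- 2 * m\<close>; the factor \<open>x / t \<le> 1\<close> only brings it into the form
        of a logarithmic rate.\<close>
      have "- 2 * m * (x / t) \<le> - 2 * m * 1"
        using m_neg x that by (intro mult_left_mono) auto
      then show ?thesis using le[OF that] by simp
    qed
    show False if "t \<ge> x" "- p t > 0" for t using p_pos[of t] that x by simp
  qed fact
qed

lemma h_tendsto_0: "(h \<longlongrightarrow> 0) (at_right 0)"
proof (rule tendsto_sandwich)
  show "\<forall>\<^sub>F x in at_right 0. 0 \<le> h x"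
    using eventually_at_right_less[of 0] by eventually_elim (use h_pos in \<open>simp add: less_imp_le\<close>)
  show "\<forall>\<^sub>F x in at_right 0. h x \<le> a * x"
    using eventually_at_right_less[of 0]
  proof eventually_elim
    case (elim x)
    have "h x * 1 \<le> h x * (x + b - 1)"
      using elim h_pos[of x] b_gt_2 by (intro mult_left_mono) auto
    then show ?case using h_le[of x] elim by simp
  qed
  show "((\<lambda>x. a * x) \<longlongrightarrow> 0) (at_right 0)" by (auto intro!: tendsto_eq_intros)
qed simp

text \<open>The definition of \<open>q\<close> is solved for \<open>(b - 1) * p\<close>. As
  \<open>p\<close> and \<open>q\<close> are bounded and \<open>h\<close> tends to 0, only the term
  \<open>a\<close> survives.\<close>

lemma p_tendsto: "(p \<longlongrightarrow> a / (b - 1)) (at_right 0)"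
proof -
  have *: "\<bar>x * q x\<bar> \<le> x * (- 2 * m)" "\<bar>(2 * h x + x) * p x\<bar> \<le> (2 * h x + x) * (a / (b - 1))"
    if "x > 0" for x
    using q_neg[OF that] q_greater[OF that] that p_less[OF that] p_pos[OF that] h_pos[OF that]
    by (auto simp: abs_mult abs_of_neg simp del: times_divide_eq_right intro!: mult_left_mono)
  have 1: "((\<lambda>x. x * q x) \<longlongrightarrow> 0) (at_right 0)"
  proof (rule Lim_null_comparison)
    show "\<forall>\<^sub>F x in at_right 0. norm (x * q x) \<le> x * (- 2 * m)"
      using eventually_at_right_less[of 0] by eventually_elim (use * in simp)
    show "((\<lambda>x. x * (- 2 * m)) \<longlongrightarrow> 0) (at_right 0)" by (auto intro!: tendsto_eq_intros)
  qed
  have 2: "((\<lambda>x. (2 * h x + x) * p x) \<longlongrightarrow> 0) (at_right 0)"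
  proof (rule Lim_null_comparison)
    show "\<forall>\<^sub>F x in at_right 0. norm ((2 * h x + x) * p x) \<le> (2 * h x + x) * (a / (b - 1))"
      using eventually_at_right_less[of 0] by eventually_elim (use * in simp)
    have "((\<lambda>x. (2 * h x + x) * (a / (b - 1))) \<longlongrightarrow> (2 * 0 + 0) * (a / (b - 1))) (at_right 0)"
      by (intro tendsto_intros h_tendsto_0) 
    then show "((\<lambda>x. (2 * h x + x) * (a / (b - 1))) \<longlongrightarrow> 0) (at_right 0)" by simp
  qed
  have "((\<lambda>x. (x * q x - (2 * h x + x) * p x - h x + a) / (b - 1)) \<longlongrightarrow> (0 - 0 - 0 + a) / (b - 1)) (at_right 0)"
    by (intro tendsto_intros 1 2 h_tendsto_0) (use b_gt_2 in auto)
  moreover have "\<forall>\<^sub>F x in at_right 0. (x * q x - (2 * h x + x) * p x - h x + a) / (b - 1) = p x"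
    using eventually_at_right_less[of 0]
    by eventually_elim (use b_gt_2 in \<open>simp add: q_def field_simps\<close>)
  ultimately show ?thesis by (simp add: Lim_transform_eventually)
qed

text \<open>By \<open>q > 2 * m\<close> the function \<open>p t - 2 * m * t\<close> is strictly
  increasing, and its limit at 0 is known.\<close>

lemma p_greater:
  assumes x: "x > 0"
  shows "p x > a / (b - 1) + 2 * m * x"
proof -
  have incr: "p s - 2 * m * s < p t - 2 * m * t" if "0 < s" "s < t" for s t
    by (rule DERIV_pos_imp_increasing[OF that(2)])
      (use q_greater that in \<open>auto intro!: exI[of _ "q _ - 2 * m"] conjI derivative_eq_intros p_deriv\<close>)
  have "((\<lambda>t. p t - 2 * m * t) \<longlongrightarrow> a / (b - 1) - 2 * m * 0) (at_right 0)"
    by (intro tendsto_intros p_tendsto)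
  \<comment> \<open>The limit preserves only the weak inequality; stopping at \<open>x / 2\<close>
    leaves room for a strict increase up to \<open>x\<close>.\<close>
  moreover have "\<forall>\<^sub>F t in at_right 0. p t - 2 * m * t \<le> p (x / 2) - 2 * m * (x / 2)"
    using eventually_at_right_real[of 0 "x / 2"] x
    by (auto elim!: eventually_mono intro!: less_imp_le incr simp del: times_divide_eq_right)
  ultimately have "a / (b - 1) - 2 * m * 0 \<le> p (x / 2) - 2 * m * (x / 2)"
    by (intro tendsto_upperbound) auto
  also have "\<dots> < p x - 2 * m * x" by (rule incr) (use x in auto)
  finally show ?thesis by simp
qed

end

section \<open>The Turan determinant\<close>

text \<open>Each bound on \<open>h\<close> is the positivity of an integral: \<open>h < a\<close>
  that of the integral with exponent \<open>c - a - 2\<close> left by the integration by parts, and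
  \<open>h_le\<close> that of the second derivative \<open>I (a + 2)\<close>.\<close>

lemma tricomi_log_derivative_riccati:
  fixes a c :: real
  assumes a: "a > 0" and c: "c < 1"
  defines "h \<equiv> \<lambda>x. x * tricomi_int (a + 1) (c - a - 1) x / tricomi_int a (c - a - 1) x"
  shows "tricomi_riccati a (1 - c) h"
proof
  define I where "I s = tricomi_int s (c - a - 1)" for s
  have e: "c - a - 1 \<le> 0" using assms by simp
  have h: "h x = x * I (a + 1) x / I a x" for x by (simp add: h_def I_def)
  fix x :: real assume x: "x > 0"
  have pos: "I a x > 0" "I (a + 1) x > 0" "I (a + 2) x > 0"
    unfolding I_def using a x e by (auto intro: tricomi_int_pos)
  have ode: "x * I (a + 2) x = a * I a x + (c - x) * I (a + 1) x"
    using tricomi_int_kummer[OF a e x] by (simp add: I_def)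
  show "h x > 0" using pos x by (simp add: h)
  have "a * I a x - x * I (a + 1) x = (a + 1 - c) * tricomi_int (a + 1) (c - a - 1 - 1) x"
    using tricomi_int_by_parts[OF a e x] by (simp add: I_def algebra_simps)
  moreover have "(a + 1 - c) * tricomi_int (a + 1) (c - a - 1 - 1) x > 0"
    using a c e x by (intro mult_pos_pos tricomi_int_pos) auto
  ultimately show "h x < a" using pos by (simp add: h field_simps)
  have "(x - c) * I (a + 1) x < a * I a x"
    using ode mult_pos_pos[OF x pos(3)] by (simp add: algebra_simps)
  then have "x * ((x - c) * I (a + 1) x) < x * (a * I a x)" using x by simp
  then show "h x * (x + (1 - c) - 1) < a * x" using pos by (simp add: h field_simps)
  have "(I a has_real_derivative - I (a + 1) x) (at x)" "(I (a + 1) has_real_derivative - I (a + 2) x) (at x)"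
    using tricomi_int_has_derivative[OF a e x] tricomi_int_has_derivative[of "a + 1", OF _ e x] a
    by (simp_all add: I_def add.assoc)
  then have "(h has_real_derivative
      ((I (a + 1) x - x * I (a + 2) x) * I a x + x * I (a + 1) x * I (a + 1) x) / (I a x)\<^sup>2) (at x)"
    unfolding h[abs_def] using pos by (auto intro!: derivative_eq_intros simp: power2_eq_square)
  moreover have "((I (a + 1) x - x * I (a + 2) x) * I a x + x * I (a + 1) x * I (a + 1) x) / (I a x)\<^sup>2
      = ((h x)\<^sup>2 + (x + (1 - c)) * h x - a * x) / x"
    unfolding ode h using pos x by (simp add: field_simps power2_eq_square)
  ultimately show "(h has_real_derivative ((h x)\<^sup>2 + (x + (1 - c)) * h x - a * x) / x) (at x)"
    by simp
qed (use a c in auto)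

text \<open>Divided by the square of \<open>tricomi a c\<close>, the determinant depends on
  \<open>x\<close> and \<open>h x\<close> alone, and it is the right-hand side of the Riccati
  equation up to a factor; thus \<open>D = h' / a\<close>. A single \<open>D\<close> for all
  \<open>x\<close> serves both the inequalities and the limits.\<close>

lemma tricomi_turan_representation:
  fixes a c :: real
  assumes a: "a > 0" and c: "c < 1"
  obtains D where
    "\<And>x. x > 0 \<Longrightarrow> (tricomi a c x)\<^sup>2 - tricomi (a - 1) (c - 1) x * tricomi (a + 1) (c + 1) x
        = - D x * (tricomi a c x)\<^sup>2"
    "\<And>x. x > 0 \<Longrightarrow> D x > 0"
    "\<And>x. x > 0 \<Longrightarrow> D x < (a + 1 - c) / x\<^sup>2"
    "\<And>x. x > 0 \<Longrightarrow> D x < 1 / (2 * x)"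
    "\<And>x. c < - 1 \<Longrightarrow> x > 0 \<Longrightarrow> D x > - (1 / c + 2 * x * ((c - a) / (c\<^sup>2 * (c + 1))))"
    "c < - 1 \<Longrightarrow> (D \<longlongrightarrow> - (1 / c)) (at_right 0)"
proof -
  define h where "h x = x * tricomi_int (a + 1) (c - a - 1) x / tricomi_int a (c - a - 1) x" for x
  interpret tricomi_riccati a "1 - c" h
    unfolding h_def[abs_def] by (rule tricomi_log_derivative_riccati[OF a c])
  define D where "D x = g x / (a * x)" for x
  show ?thesis
  proof
    fix x :: real assume x: "x > 0"
    define I J G where "I = tricomi_int a (c - a - 1) x" and "J = tricomi_int (a + 1) (c - a - 1) x"
      and "G = Gamma a"
    have pos: "I > 0" "G > 0"
      unfolding I_def G_def using a c x by (auto intro: tricomi_int_pos Gamma_real_pos)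
    have up: "tricomi (a + 1) (c + 1) x = J / (a * G)"
      using tricomi_eq_integral[of "a + 1" "c + 1" x] a c x
        Gamma_plus1[of a] nonpos_Ints_nonpos[of a] by (auto simp: J_def G_def)
    have mid: "tricomi a c x = I / G"
      using tricomi_eq_integral[of a c x] a c x by (simp add: I_def G_def)
    have down: "tricomi (a - 1) (c - 1) x = ((x + 1 - c) * I + x * J) / G"
      using tricomi_shift_down_eq_integral[of a c x] a c x by (simp add: I_def J_def G_def)
    have "g x = ((x * J)\<^sup>2 + (x + (1 - c)) * (x * J) * I - a * x * I\<^sup>2) / I\<^sup>2"
      unfolding g_def h_def I_def[symmetric] J_def[symmetric] using pos
      by (simp add: field_simps power2_eq_square)
    then have D_eq: "- D x = (a * x * I\<^sup>2 - (x * J)\<^sup>2 - (x + (1 - c)) * (x * J) * I) / (a * x * I\<^sup>2)"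
      using pos a x by (simp add: D_def divide_simps)
    then show "(tricomi a c x)\<^sup>2 - tricomi (a - 1) (c - 1) x * tricomi (a + 1) (c + 1) x
        = - D x * (tricomi a c x)\<^sup>2"
      unfolding up mid down D_eq using pos a x by (simp add: field_simps power2_eq_square)
    show "D x > 0" using g_pos[OF x] a x by (simp add: D_def)
    show "D x < (a + 1 - c) / x\<^sup>2"
      using g_less_quotient[OF x] a x by (simp add: D_def field_simps power2_eq_square)
    show "D x < 1 / (2 * x)"
      using g_less_half[OF x] a x by (simp add: D_def field_simps)
  next
    assume c': "c < - 1"
    interpret tricomi_riccati_large a "1 - c" h
      by unfold_locales (use c' in simp)
    have D: "D x = p x / a" for x by (simp add: D_def p_def)
    show "D x > - (1 / c + 2 * x * ((c - a) / (c\<^sup>2 * (c + 1))))" if x: "x > 0" for x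
    proof -
      have "(a / (1 - c - 1) + 2 * m * x) / a < D x"
        unfolding D using p_greater[OF x] a by (intro divide_strict_right_mono) auto
      \<comment> \<open>With \<open>b = 1 - c\<close> one has
        \<open>(b - 1)\<^sup>2 = c\<^sup>2\<close>, \<open>b - 2 = - (c + 1)\<close> and
        \<open>a + b - 1 = a - c\<close>, which turns \<open>m\<close> into the coefficient of the
        claim.\<close>
      moreover have "m / a = - ((c - a) / (c\<^sup>2 * (c + 1)))"
      proof -
        have "c \<noteq> 0" "c + 1 \<noteq> 0" using c' by auto
        then have "m * (c\<^sup>2 * (c + 1)) = a * (a - c)"
          by (simp add: m_def divide_simps) (simp add: algebra_simps)
        then show ?thesis using a \<open>c \<noteq> 0\<close> \<open>c + 1 \<noteq> 0\<close>
          by (simp add: divide_simps)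
      qed
      moreover have "(a / (1 - c - 1) + 2 * m * x) / a = - (1 / c) + 2 * x * (m / a)"
        using a by (simp add: add_divide_distrib diff_divide_distrib)
      ultimately show ?thesis by simp
    qed
    have "((\<lambda>x. p x / a) \<longlongrightarrow> a / (1 - c - 1) / a) (at_right 0)"
      by (intro tendsto_intros p_tendsto) (use a in simp)
    then show "(D \<longlongrightarrow> - (1 / c)) (at_right 0)"
      using a by (simp add: D[abs_def])
  qed
qed

section \<open>Sharpness and assembly of the inequalities\<close>

lemma tricomi_pos: "a > 0 \<Longrightarrow> c < 1 \<Longrightarrow> x > 0 \<Longrightarrow> tricomi a c x > 0"
  using tricomi_eq_integral[of a c x] tricomi_int_pos[of a "c - a - 1" x] Gamma_real_pos[of a] by simp

lemma sharp_rel_multiples: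
  assumes "\<forall>\<^sub>F x in F. d x \<noteq> 0 \<and> l x = A x * d x \<and> r x = B x * d x"
    "(A \<longlongrightarrow> L) F" "(B \<longlongrightarrow> L) F"
  shows "sharp_rel d l r F"
  unfolding sharp_rel_def
proof (intro exI conjI)
  show "((\<lambda>x. l x / d x) \<longlongrightarrow> L) F"
    using assms(1) by (intro Lim_transform_eventually[OF assms(2)]) (auto elim: eventually_mono)
  show "((\<lambda>x. r x / d x) \<longlongrightarrow> L) F"
    using assms(1) by (intro Lim_transform_eventually[OF assms(3)]) (auto elim: eventually_mono)
qed

theorem theorem1:
  shows
    "(\<forall>a c x :: real. a > 0 \<and> c < 1 \<and> x > 0 \<longrightarrow>
        (c - a - 1) / x\<^sup>2 * (tricomi a c x)\<^sup>2
          < (tricomi a c x)\<^sup>2 - tricomi (a - 1) (c - 1) x * tricomi (a + 1) (c + 1) x)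
   \<and> (\<forall>a c x :: real. a > 1 \<and> c < -1 \<and> x > 0 \<longrightarrow>
        (tricomi a c x)\<^sup>2 - tricomi (a - 1) (c - 1) x * tricomi (a + 1) (c + 1) x
          < (1 / c + 2 * x * ((c - a) / (c\<^sup>2 * (c + 1)))) * (tricomi a c x)\<^sup>2)
   \<and> (\<forall>a c x :: real. a > 0 \<and> c < 1 \<and> x > 0 \<longrightarrow>
        - (1 / (2 * x)) * (tricomi a c x)\<^sup>2
          < (tricomi a c x)\<^sup>2 - tricomi (a - 1) (c - 1) x * tricomi (a + 1) (c + 1) x)
   \<and> (\<forall>a c :: real. a > 0 \<and> c < 1 \<longrightarrow>
        sharp_rel (\<lambda>x. (tricomi a c x)\<^sup>2)
          (\<lambda>x. (c - a - 1) / x\<^sup>2 * (tricomi a c x)\<^sup>2)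
          (\<lambda>x. (tricomi a c x)\<^sup>2 - tricomi (a - 1) (c - 1) x * tricomi (a + 1) (c + 1) x)
          at_top)
   \<and> (\<forall>a c :: real. a > 0 \<and> c < 1 \<longrightarrow>
        sharp_rel (\<lambda>x. (tricomi a c x)\<^sup>2)
          (\<lambda>x. - (1 / (2 * x)) * (tricomi a c x)\<^sup>2)
          (\<lambda>x. (tricomi a c x)\<^sup>2 - tricomi (a - 1) (c - 1) x * tricomi (a + 1) (c + 1) x)
          at_top)
   \<and> (\<forall>a c :: real. a > 1 \<and> c < -1 \<longrightarrow>
        sharp_rel (\<lambda>x. (tricomi a c x)\<^sup>2)
          (\<lambda>x. (tricomi a c x)\<^sup>2 - tricomi (a - 1) (c - 1) x * tricomi (a + 1) (c + 1) x)
          (\<lambda>x. (1 / c + 2 * x * ((c - a) / (c\<^sup>2 * (c + 1)))) * (tricomi a c x)\<^sup>2)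
          (at_right 0))"
proof (intro conjI allI impI; elim conjE)
  fix a c x :: real assume ac: "a > 0" "c < 1" and x: "x > 0"
  then obtain D where D: "(tricomi a c x)\<^sup>2 - tricomi (a - 1) (c - 1) x * tricomi (a + 1) (c + 1) x
      = - D x * (tricomi a c x)\<^sup>2" "D x < (a + 1 - c) / x\<^sup>2" "D x < 1 / (2 * x)"
    using tricomi_turan_representation[of a c] by metis
  have pos: "(tricomi a c x)\<^sup>2 > 0" using tricomi_pos[OF ac x] by simp
  have "(c - a - 1) / x\<^sup>2 = - ((a + 1 - c) / x\<^sup>2)"
    by (simp add: minus_divide_left)
  then have "(c - a - 1) / x\<^sup>2 < - D x" using D(2) by linarith
  then show "(c - a - 1) / x\<^sup>2 * (tricomi a c x)\<^sup>2
      < (tricomi a c x)\<^sup>2 - tricomi (a - 1) (c - 1) x * tricomi (a + 1) (c + 1) x"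
    unfolding D(1) using pos by (intro mult_strict_right_mono)
  have "- (1 / (2 * x)) < - D x" using D(3) by simp
  then show "- (1 / (2 * x)) * (tricomi a c x)\<^sup>2
      < (tricomi a c x)\<^sup>2 - tricomi (a - 1) (c - 1) x * tricomi (a + 1) (c + 1) x"
    unfolding D(1) using pos by (intro mult_strict_right_mono)
next
  fix a c x :: real assume ac: "a > 1" "c < - 1" and x: "x > 0"
  then obtain D where D: "(tricomi a c x)\<^sup>2 - tricomi (a - 1) (c - 1) x * tricomi (a + 1) (c + 1) x
      = - D x * (tricomi a c x)\<^sup>2" "D x > - (1 / c + 2 * x * ((c - a) / (c\<^sup>2 * (c + 1))))"
    using tricomi_turan_representation[of a c] by (smt (verit))
  have pos: "(tricomi a c x)\<^sup>2 > 0" using tricomi_pos[of a c x] ac x by simp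
  have "- D x < 1 / c + 2 * x * ((c - a) / (c\<^sup>2 * (c + 1)))" using D(2) by linarith
  then show "(tricomi a c x)\<^sup>2 - tricomi (a - 1) (c - 1) x * tricomi (a + 1) (c + 1) x
      < (1 / c + 2 * x * ((c - a) / (c\<^sup>2 * (c + 1)))) * (tricomi a c x)\<^sup>2"
    unfolding D(1) using pos by (intro mult_strict_right_mono)
next
  fix a c :: real assume ac: "a > 0" "c < 1"
  obtain D where D: "\<And>x. x > 0 \<Longrightarrow> (tricomi a c x)\<^sup>2 - tricomi (a - 1) (c - 1) x * tricomi (a + 1) (c + 1) x
        = - D x * (tricomi a c x)\<^sup>2"
      "\<And>x. x > 0 \<Longrightarrow> D x > 0" "\<And>x. x > 0 \<Longrightarrow> D x < (a + 1 - c) / x\<^sup>2"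
    using tricomi_turan_representation[OF ac] by metis
  \<comment> \<open>The common limit in both sharpness claims at infinity is 0, by squeezing
    \<open>D\<close> between 0 and the bound of (i).\<close>
  have "(D \<longlongrightarrow> 0) at_top"
  proof (rule tendsto_sandwich)
    show "\<forall>\<^sub>F x in at_top. 0 \<le> D x"
      using eventually_gt_at_top[of 0] by eventually_elim (use D(2) in \<open>simp add: less_imp_le\<close>)
    show "\<forall>\<^sub>F x in at_top. D x \<le> (a + 1 - c) / x\<^sup>2"
      using eventually_gt_at_top[of 0] by eventually_elim (use D(3) in \<open>simp add: less_imp_le\<close>)
    show "((\<lambda>x. (a + 1 - c) / x\<^sup>2) \<longlongrightarrow> 0) at_top" by real_asymp
  qed simp
  then have lim: "((\<lambda>x. - D x) \<longlongrightarrow> 0) at_top" using tendsto_minus by fastforce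
  have lims: "((\<lambda>x. (c - a - 1) / x\<^sup>2) \<longlongrightarrow> 0) at_top" "((\<lambda>x::real. - (1 / (2 * x))) \<longlongrightarrow> 0) at_top"
    by real_asymp+
  show "sharp_rel (\<lambda>x. (tricomi a c x)\<^sup>2) (\<lambda>x. (c - a - 1) / x\<^sup>2 * (tricomi a c x)\<^sup>2)
      (\<lambda>x. (tricomi a c x)\<^sup>2 - tricomi (a - 1) (c - 1) x * tricomi (a + 1) (c + 1) x) at_top"
    by (rule sharp_rel_multiples[OF _ lims(1) lim], rule eventually_mono[OF eventually_gt_at_top[of 0]])
      (use D(1) tricomi_pos[OF ac] in fastforce)
  show "sharp_rel (\<lambda>x. (tricomi a c x)\<^sup>2) (\<lambda>x. - (1 / (2 * x)) * (tricomi a c x)\<^sup>2)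
      (\<lambda>x. (tricomi a c x)\<^sup>2 - tricomi (a - 1) (c - 1) x * tricomi (a + 1) (c + 1) x) at_top"
    by (rule sharp_rel_multiples[OF _ lims(2) lim], rule eventually_mono[OF eventually_gt_at_top[of 0]])
      (use D(1) tricomi_pos[OF ac] in fastforce)
next
  fix a c :: real assume ac: "a > 1" "c < - 1"
  obtain D where D: "\<And>x. x > 0 \<Longrightarrow> (tricomi a c x)\<^sup>2 - tricomi (a - 1) (c - 1) x * tricomi (a + 1) (c + 1) x
        = - D x * (tricomi a c x)\<^sup>2" "(D \<longlongrightarrow> - (1 / c)) (at_right 0)"
    using tricomi_turan_representation[of a c] ac by (smt (verit))
  have lim: "((\<lambda>x. - D x) \<longlongrightarrow> 1 / c) (at_right 0)" using tendsto_minus[OF D(2)] by simp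
  have lim': "((\<lambda>x. 1 / c + 2 * x * ((c - a) / (c\<^sup>2 * (c + 1)))) \<longlongrightarrow> 1 / c) (at_right 0)"
    using ac by (auto intro!: tendsto_eq_intros)
  have pos: "tricomi a c x > 0" if "x > 0" for x using tricomi_pos[of a c x] ac that by simp
  show "sharp_rel (\<lambda>x. (tricomi a c x)\<^sup>2)
      (\<lambda>x. (tricomi a c x)\<^sup>2 - tricomi (a - 1) (c - 1) x * tricomi (a + 1) (c + 1) x)
      (\<lambda>x. (1 / c + 2 * x * ((c - a) / (c\<^sup>2 * (c + 1)))) * (tricomi a c x)\<^sup>2) (at_right 0)"
    by (rule sharp_rel_multiples[OF _ lim lim'], rule eventually_mono[OF eventually_at_right_less[of 0]])
      (use D(1) pos in fastforce)
qed

end
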